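(* Let $n\geq 2$ be an integer. If $n+1$ is a prime number, or $n$ is a power $p^{m}$ ($m\ge 1$) of a prime number $p$, then $f_{1,n}(x)=x^{n-1}+2x^{n-2}+3x^{n-3}+\cdots+(n-1)x+n$ is irreducible over $\mathbb{Z}$.
   Context: For a positive integer $n$, $f_{1,n}(x)=\sum_{k=1}^{n} k\,x^{n-k}\in\mathbb{Z}[x]$, a monic polynomial of degree $n-1$. *)

theory Defs
  imports "HOL-Computational_Algebra.Computational_Algebra"
begin

definition f1 :: "nat \<Rightarrow> int poly" where
  "f1 n = (\<Sum>k = 1..n. monom (int k) (n - k))"

end

theory Submission
  imports Defs
begin

text \<open>
  Everything rests on the identity $(x-1)^2 f_{1,n}(x) = x^{n+1} - (n+1)x + n$.
  If $n+1$ is prime, it shows that the coefficients of $f_{1,n}(x+1)$ are the binomial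
  coefficients $n+1$ over $i+2$, and Eisenstein's criterion applies.
  If $n = p^m$, all complex roots of $f_{1,n}$ lie outside the closed unit disc, so the constant
  terms of two nontrivial factors are not units; as their product is $p^m$, both are divisible
  by $p$. Then $p$ divides the linear coefficient $n - 1$ of $f_{1,n}$, which is absurd.
\<close>

section \<open>Irreducibility criteria for monic polynomials over an integral domain\<close>

lemma irreducible_monicI:
  fixes f :: "'a::idom poly"
  assumes monic: "lead_coeff f = 1" and deg: "degree f > 0"
    and no_factor: "\<And>g h. f = g * h \<Longrightarrow> degree g > 0 \<Longrightarrow> degree h > 0 \<Longrightarrow> False"
  shows "irreducible f"
proof (rule irreducibleI)
  show "f \<noteq> 0" using deg by auto
  show "\<not> f dvd 1" using deg by (auto simp: is_unit_poly_iff)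
  fix g h assume f: "f = g * h"
  \<comment> \<open>Both leading coefficients are units, so a factor of degree 0 is a unit; monicity
    plays the part of primitivity.\<close>
  have lc: "lead_coeff g * lead_coeff h = 1"
    using monic by (simp add: f lead_coeff_mult)
  have unit: "q dvd 1" if "degree q = 0" "lead_coeff q dvd 1" for q :: "'a poly"
    using that by (metis degree_0_id is_unit_const_poly_iff)
  have "lead_coeff g dvd 1" "lead_coeff h dvd 1"
    using lc by (metis dvd_triv_left, metis dvd_triv_right)
  then show "g dvd 1 \<or> h dvd 1"
    using no_factor[OF f] unit by blast
qed

text \<open>The conditions on \<open>coeff f 0\<close> make \<open>p\<close> divide the constant
  term of exactly one of two factors. That factor must carry the full degree of \<open>f\<close>, so
  the other one is constant.\<close>

theorem eisenstein_criterion: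
  fixes f :: "'a::idom poly"
  assumes p: "prime_elem p" and monic: "lead_coeff f = 1" and deg: "degree f > 0"
    and low: "\<And>i. i < degree f \<Longrightarrow> p dvd coeff f i"
    and const: "\<not> p ^ 2 dvd coeff f 0"
  shows "irreducible f"
proof (rule irreducible_monicI[OF monic deg])
  have full_degree: "degree h = 0"
    if f: "f = g * h" and g0: "p dvd coeff g 0" and h0: "\<not> p dvd coeff h 0" for g h
  proof -
    have "lead_coeff g * lead_coeff h = 1"
      using monic by (simp add: f lead_coeff_mult)
    then have "\<not> p dvd lead_coeff g"
      using p by (metis dvd_mult2 prime_elem_not_unit)
    \<comment> \<open>At the first index \<open>i\<close> where \<open>p\<close> fails to divide
      \<open>coeff g i\<close>, the only summand of \<open>coeff f i\<close> not divisible by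
      \<open>p\<close> is \<open>coeff g i * coeff h 0\<close>. Hence \<open>i\<close> is not below
      \<open>degree f\<close>.\<close>
    then obtain i where i: "\<not> p dvd coeff g i" and min: "\<And>j. j < i \<Longrightarrow> p dvd coeff g j"
      using exists_least_iff[of "\<lambda>i. \<not> p dvd coeff g i"] by blast
    have "coeff f i = (\<Sum>j<i. coeff g j * coeff h (i - j)) + coeff g i * coeff h 0"
      by (simp add: f coeff_mult lessThan_Suc_atMost[symmetric])
    moreover have "p dvd (\<Sum>j<i. coeff g j * coeff h (i - j))"
      using min by (intro dvd_sum) auto
    ultimately have "\<not> p dvd coeff f i"
      using i h0 p by (simp add: dvd_add_right_iff prime_elem_dvd_mult_iff)
    then have "degree f \<le> i" using low not_le by blast
    also have "i \<le> degree g"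
      using i by (intro le_degree) auto
    finally have "degree f \<le> degree g" .
    moreover have "g \<noteq> 0" "h \<noteq> 0" using deg f by auto
    ultimately show ?thesis by (simp add: f degree_mult_eq)
  qed
  fix g h assume f: "f = g * h" and dg: "degree g > 0" and dh: "degree h > 0"
  have "p dvd coeff g 0 * coeff h 0"
    using low[OF deg] by (simp add: f coeff_mult_0)
  moreover have "\<not> (p dvd coeff g 0 \<and> p dvd coeff h 0)"
    using const by (auto simp: f coeff_mult_0 power2_eq_square intro: mult_dvd_mono)
  ultimately consider "p dvd coeff g 0" "\<not> p dvd coeff h 0"
    | "p dvd coeff h 0" "\<not> p dvd coeff g 0"
    using p by (auto simp: prime_elem_dvd_mult_iff)
  then show False
  proof cases
    case 1 then show False using full_degree[OF f] dh by simp
  next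
    case 2 then show False using full_degree[of h g] f dg by (simp add: mult.commute)
  qed
qed

text \<open>Translation by \<open>c\<close> is a ring automorphism with inverse translation by
  \<open>- c\<close>, so it carries factorizations over and preserves units in both
  directions.\<close>

lemma irreducible_pcompose_translateD:
  fixes f :: "'a::idom poly"
  assumes "irreducible (pcompose f [:c, 1:])"
  shows "irreducible f"
proof (rule irreducibleI)
  have unit: "pcompose a q dvd 1" if "a dvd 1" for a q :: "'a poly"
    using that by (metis dvdE dvdI pcompose_1 pcompose_mult)
  have translate_back: "pcompose (pcompose a [:c, 1:]) [:- c, 1:] = a" for a
    by (simp flip: pcompose_assoc add: pcompose_pCons)
  show "f \<noteq> 0" using assms by auto
  show "\<not> f dvd 1" using assms unit irreducible_not_unit by blast
  fix a b assume "f = a * b"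
  then have "pcompose a [:c, 1:] dvd 1 \<or> pcompose b [:c, 1:] dvd 1"
    using irreducibleD[OF assms] by (simp add: pcompose_mult)
  then show "a dvd 1 \<or> b dvd 1"
    using unit translate_back by metis
qed

section \<open>Recursion, coefficients and closed form of \<open>f1\<close>\<close>

lemma pCons_0_sum: "(\<Sum>k\<in>A. pCons 0 (g k)) = pCons 0 (\<Sum>k\<in>A. g k)"
  by (induction A rule: infinite_finite_induct) simp_all

lemma f1_Suc: "f1 (Suc n) = pCons (int (Suc n)) (f1 n)"
proof -
  have "(\<Sum>k = 1..n. monom (int k) (Suc n - k)) = (\<Sum>k = 1..n. pCons 0 (monom (int k) (n - k)))"
    by (intro sum.cong) (auto simp: Suc_diff_le monom_Suc)
  also have "\<dots> = pCons 0 (f1 n)"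
    unfolding f1_def by (rule pCons_0_sum)
  finally show ?thesis
    by (simp add: f1_def monom_0)
qed

lemma f1_0 [simp]: "f1 0 = 0"
  by (simp add: f1_def)

text \<open>Truncated subtraction on naturals keeps the formula correct for
  \<open>i \<ge> n\<close>, where both sides are 0.\<close>

lemma coeff_f1: "coeff (f1 n) i = int (n - i)"
  by (induction n arbitrary: i) (auto simp: f1_Suc coeff_pCons split: nat.splits)

lemma degree_f1: "degree (f1 n) = n - 1"
proof (cases "n = 0")
  case False
  then show ?thesis
    by (intro antisym degree_le le_degree) (auto simp: coeff_f1)
qed simp

lemma lead_coeff_f1: "n > 0 \<Longrightarrow> lead_coeff (f1 n) = 1"
  by (simp add: degree_f1 coeff_f1)

text \<open>Induction along the Horner recursion \<open>f1_Suc\<close>: adding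
  \<open>(n+1)(x-1)^2\<close> to \<open>x\<close> times the identity for \<open>n\<close> cancels
  the \<open>x^2\<close> terms of the linear correction.\<close>

lemma f1_closed_form: "[:-1, 1:] ^ 2 * f1 n = [:0, 1:] ^ Suc n - [:- int n, int (Suc n):]"
proof (induction n)
  case (Suc n)
  have "f1 (Suc n) = [:int (Suc n):] + [:0, 1:] * f1 n"
    by (simp add: f1_Suc)
  then have "[:-1, 1:] ^ 2 * f1 (Suc n) =
      [:-1, 1:] ^ 2 * [:int (Suc n):] + [:0, 1:] * ([:-1, 1:] ^ 2 * f1 n)"
    by (simp only: distrib_left mult.left_commute)
  then show ?case
    unfolding Suc.IH by (simp add: power2_eq_square algebra_simps)
qed simp

text \<open>After \<open>x\<close> is replaced by \<open>x + 1\<close> in the closed form, the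
  subtracted \<open>1 + (n+1)x\<close> is exactly the start of the binomial expansion of
  \<open>(x+1)^(n+1)\<close>; the factor \<open>x^2\<close> shifts the index by 2.\<close>

lemma coeff_f1_translate: "coeff (pcompose (f1 n) [:1, 1:]) i = int (Suc n choose (i + 2))"
proof -
  have lin: "pcompose [:a, b:] [:1, 1:] = [:a + b, b:]" for a b :: int
    by (simp add: pcompose_pCons)
  have pow: "pcompose (q ^ k) r = pcompose q r ^ k" for q r :: "int poly" and k
    by (induction k) (simp_all add: pcompose_mult pcompose_1)
  have "[:0, 1:] ^ 2 * pcompose (f1 n) [:1, 1:] = [:1, 1:] ^ Suc n - [:1, int (Suc n):]"
    using arg_cong[OF f1_closed_form[of n], of "\<lambda>q. pcompose q [:1, 1:]"]
    by (simp only: pcompose_mult pcompose_diff pow lin) simp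
  then have "coeff ([:0, 1:] ^ 2 * pcompose (f1 n) [:1, 1:]) (i + 2)
      = coeff ([:1, 1:] ^ Suc n) (i + 2)"
    by (simp add: coeff_pCons)
  moreover have "coeff ([:0, 1:] ^ 2 * pcompose (f1 n) [:1, 1:]) (i + 2)
      = coeff (pcompose (f1 n) [:1, 1:]) i"
    by (simp add: power2_eq_square)
  moreover have "coeff ([:1, 1:] ^ Suc n :: int poly) (i + 2) = int (Suc n choose (i + 2))"
  proof (cases "i + 2 \<le> Suc n")
    case True
    then show ?thesis
      using coeff_linear_poly_power[OF True, of "1::int" 1] by simp
  next
    case False
    have "degree ([:1, 1:] ^ Suc n :: int poly) \<le> Suc n"
      using degree_power_le[of "[:1, 1:] :: int poly" "Suc n"] by simp
    with False show ?thesis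
      by (simp add: coeff_eq_0 binomial_eq_0 del: power_Suc binomial_Suc_Suc)
  qed
  ultimately show ?thesis by simp
qed

section \<open>The case of a prime \<open>n + 1\<close>\<close>

lemma irreducible_f1_Suc_prime:
  assumes n: "n \<ge> 2" and p: "prime (Suc n)"
  shows "irreducible (f1 n)"
proof (rule irreducible_pcompose_translateD, rule eisenstein_criterion)
  let ?F = "pcompose (f1 n) [:1, 1:]"
  have deg: "degree ?F = n - 1"
    by (simp add: degree_pcompose degree_f1)
  have i: "n - 1 + 2 = Suc n" using n by simp
  show "prime_elem (int (Suc n))"
    using p by (simp only: prime_imp_prime_elem prime_nat_int_transfer)
  show "lead_coeff ?F = 1"
    unfolding deg coeff_f1_translate i by simp
  show "degree ?F > 0" using n deg by simp
  \<comment> \<open>Here \<open>i < n - 1\<close>, so \<open>i + 2\<close> lies strictly between 0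
    and the prime \<open>Suc n\<close>.\<close>
  show "int (Suc n) dvd coeff ?F i" if "i < degree ?F" for i
    unfolding coeff_f1_translate int_dvd_int_iff
    using that p by (intro dvd_choose_prime) (simp_all add: deg)
  show "\<not> int (Suc n) ^ 2 dvd coeff ?F 0"
  proof
    assume "int (Suc n) ^ 2 dvd coeff ?F 0"
    then have "Suc n ^ 2 dvd (Suc n choose 2)"
      unfolding coeff_f1_translate add_0 of_nat_power[symmetric] int_dvd_int_iff .
    \<comment> \<open>Doubling turns the binomial coefficient into \<open>Suc n * n\<close> without
      a division.\<close>
    then have "Suc n ^ 2 dvd 2 * (Suc n choose 2)" by (rule dvd_mult)
    also have "2 * (Suc n choose 2) = Suc n * n"
      by (simp add: choose_two)
    finally have "Suc n dvd n"
      by (simp only: power2_eq_square nat_mult_dvd_cancel_disj) simp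
    then show False using n by (auto dest: dvd_imp_le)
  qed
qed

section \<open>Complex roots of \<open>f1 n\<close> and the case of a prime power\<close>

lemma map_poly_of_int_mult:
  "map_poly (of_int :: int \<Rightarrow> 'a::comm_ring_1) (g * h) = map_poly of_int g * map_poly of_int h"
  by (rule poly_eqI) (simp add: coeff_map_poly coeff_mult)

text \<open>A single factor \<open>z - 1\<close> gives
  \<open>(z-1) f(z) = z + ... + z^n - n\<close>, so at a root the \<open>n\<close> powers sum to
  \<open>n\<close>. If \<open>norm z \<le> 1\<close>, each real part is at most 1, hence all equal
  1; this forces \<open>z = 1\<close>, where the value is positive.\<close>

lemma norm_root_f1_gt_1:
  fixes z :: complex
  assumes n: "n > 0" and root: "poly (map_poly of_int (f1 n)) z = 0"
  shows "norm z > 1"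
proof (rule ccontr)
  assume "\<not> norm z > 1"
  then have z: "norm z \<le> 1" by simp
  define P where "P k = poly (map_poly of_int (f1 k)) z" for k
  have P_Suc: "P (Suc k) = of_nat (Suc k) + z * P k" for k
    by (simp add: P_def f1_Suc map_poly_pCons)
  have geometric: "(z - 1) * P k = (\<Sum>j = 1..k. z ^ j) - of_nat k" for k
  proof (induction k)
    case (Suc k)
    have "(z - 1) * P (Suc k) = (z - 1) * of_nat (Suc k) + z * ((z - 1) * P k)"
      unfolding P_Suc by (simp add: algebra_simps)
    also have "\<dots> = z + z * (\<Sum>j = 1..k. z ^ j) - of_nat (Suc k)"
      unfolding Suc.IH by (simp add: algebra_simps)
    also have "z + z * (\<Sum>j = 1..k. z ^ j) = (\<Sum>j = 0..k. z * z ^ j)"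
      by (simp add: sum.atLeast_Suc_atMost sum_distrib_left)
    also have "\<dots> = (\<Sum>j = 1..Suc k. z ^ j)"
      by (simp only: One_nat_def sum.atLeast_Suc_atMost_Suc_shift o_def power_Suc)
    finally show ?case .
  qed (simp add: P_def)
  have sum: "(\<Sum>j = 1..n. z ^ j) = of_nat n"
    using geometric[of n] root by (simp add: P_def)
  have Re_le: "Re (z ^ j) \<le> 1" for j
    using complex_Re_le_cmod[of "z ^ j"] power_le_one[of "norm z" j] z by (simp add: norm_power)
  have "(\<Sum>j = 1..n. 1 - Re (z ^ j)) = 0"
    using arg_cong[OF sum, of Re] by (simp add: sum_subtractf)
  then have "\<forall>j\<in>{1..n}. 1 - Re (z ^ j) = 0"
    using Re_le by (subst (asm) sum_nonneg_eq_0_iff) auto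
  then have "Re z = 1" using n by force
  moreover have "Re z ^ 2 + Im z ^ 2 \<le> 1"
    using z by (simp add: cmod_def)
  ultimately have "z = 1" by (simp add: complex_eq_iff)
  \<comment> \<open>At \<open>z = 1\<close> the identity \<open>geometric\<close> reads
    \<open>0 = 0\<close>, so this point is excluded by the recursion itself.\<close>
  have "Re (P k) \<ge> real k" for k
    by (induction k) (simp_all add: P_Suc \<open>z = 1\<close>, simp add: P_def)
  from this[of n] show False using root n by (simp add: P_def)
qed

text \<open>By Vieta the constant term is the leading coefficient times the product of the negated
  roots; positive degree makes this product nonempty, hence the strict inequality.\<close>

lemma norm_coeff_0_gt_lead_coeff:
  fixes q :: "complex poly"
  assumes deg: "degree q > 0" and roots: "\<And>z. poly q z = 0 \<Longrightarrow> norm z > 1"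
  shows "norm (coeff q 0) > norm (lead_coeff q)"
proof -
  have "q \<noteq> 0" using deg by auto
  then obtain A where A: "size A = degree q" "q = smult (lead_coeff q) (\<Prod>x\<in>#A. [:- x, 1:])"
    using alg_closed_imp_factorization by blast
  have poly_q: "poly q z = lead_coeff q * (\<Prod>x\<in>#A. z - x)" for z
    by (subst A(2)) (simp add: poly_prod_mset)
  have "norm x > 1" if "x \<in># A" for x
    using that by (intro roots) (auto simp: poly_q prod_mset_zero_iff)
  moreover have "A \<noteq> {#}" using A(1) deg by auto
  ultimately have "norm (\<Prod>x\<in>#A. 0 - x) > 1"
  proof (induction A)
    case (add a A)
    show ?case
    proof (cases "A = {#}")
      case False
      then have "norm (\<Prod>x\<in>#A. 0 - x) > 1" using add by simp
      then show ?thesis using add.prems less_1_mult[of "norm a"] by (simp add: norm_mult)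
    qed (use add.prems in simp)
  qed simp
  moreover have "norm (lead_coeff q) > 0" using \<open>q \<noteq> 0\<close> by simp
  ultimately show ?thesis
    by (simp add: poly_0_coeff_0[symmetric] poly_q norm_mult)
qed

lemma irreducible_f1_prime_power:
  assumes p: "prime (p :: nat)" and m: "m \<ge> 1" and n: "n = p ^ m" "n \<ge> 2"
  shows "irreducible (f1 n)"
proof (rule irreducible_monicI)
  show "lead_coeff (f1 n) = 1" using n(2) by (intro lead_coeff_f1) linarith
  show "degree (f1 n) > 0" using n by (simp add: degree_f1)
  have dvd_coeff_0: "int p dvd coeff g 0" if f: "f1 n = g * h" and deg: "degree g > 0" for g h
  proof (rule ccontr)
    assume "\<not> int p dvd coeff g 0"
    then have "coprime (int p ^ m) (coeff g 0)"
      using p by (simp add: prime_imp_coprime)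
    moreover have "coeff g 0 * coeff h 0 = int p ^ m"
      using coeff_f1[of n 0] by (simp add: f[symmetric] n flip: coeff_mult_0)
    then have "coeff g 0 dvd int p ^ m"
      by (metis dvd_triv_left)
    ultimately have "coeff g 0 dvd 1"
      by (metis coprime_common_divisor dvd_refl)
    then have "\<bar>coeff g 0\<bar> = 1" by simp
    \<comment> \<open>A nonzero integer has absolute value at least 1, so the norm inequality
      contradicts \<open>coeff g 0\<close> being a unit.\<close>
    moreover have "lead_coeff g \<noteq> 0" using deg by auto
    moreover have "norm (coeff (map_poly of_int g) 0 :: complex)
        > norm (lead_coeff (map_poly of_int g) :: complex)"
    proof (rule norm_coeff_0_gt_lead_coeff)
      show "degree (map_poly of_int g :: complex poly) > 0"
        using deg by (simp add: degree_map_poly)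
      fix z :: complex assume "poly (map_poly of_int g) z = 0"
      then have "poly (map_poly of_int (f1 n)) z = 0"
        by (simp add: f map_poly_of_int_mult)
      then show "norm z > 1" using n(2) by (intro norm_root_f1_gt_1) auto
    qed
    ultimately show False
      by (simp add: coeff_map_poly degree_map_poly flip: of_int_abs)
  qed
  fix g h assume f: "f1 n = g * h" and deg: "degree g > 0" "degree h > 0"
  have "int p dvd coeff g 0" "int p dvd coeff h 0"
    using dvd_coeff_0[of g h] dvd_coeff_0[of h g] f deg by (simp_all add: mult.commute)
  \<comment> \<open>Each of the two products making up the linear coefficient contains the constant
    term of \<open>g\<close> or of \<open>h\<close>.\<close>
  then have "int p dvd coeff (f1 n) 1"
    by (simp add: f coeff_mult)
  then have "p dvd n - 1" by (simp add: coeff_f1)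
  moreover have "p dvd n" using m by (simp add: n)
  ultimately have "p dvd 1"
    using n by (metis One_nat_def diff_diff_cancel dvd_diff_nat le_trans one_le_numeral)
  then show False using p by simp
qed

theorem mainTheorem5:
  fixes n :: nat
  assumes "n \<ge> 2"
    and "prime (n + 1) \<or> (\<exists>p m :: nat. prime p \<and> m \<ge> 1 \<and> n = p ^ m)"
  shows "irreducible (f1 n)"
  using assms irreducible_f1_Suc_prime irreducible_f1_prime_power by auto

end
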